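(* Let $(x^k)_{k\in\mathbb{N}}$ be the sequence generated by the PSS Method with exogenous stepsizes, i.e. $\alpha_k=\beta_k/\eta_k$ with $\eta_k:=\max\{1,\|u^k\|\}$, $\beta_k>0$ for all $k$, $\sum_{k=0}^\infty\beta_k^2<+\infty$ and $\sum_{k=0}^\infty\beta_k=+\infty$. Suppose there exists $\bar x\in\operatorname{dom}(g)$ such that $(f+g)(\bar x)\le (f+g)(x^k)$ for all $k\in\mathbb{N}$, and set $\mathcal{L}_{f+g}(\bar x):=\{x\in\operatorname{dom}(g):(f+g)(x)\le (f+g)(\bar x)\}$. Then: (a) The sequence $(x^k)_{k\in\mathbb{N}}$ is quasi-Fejér convergent to $\mathcal{L}_{f+g}(\bar x)$. (b) $\lim_{k\to\infty}(f+g)(x^k)=(f+g)(\bar x)$. (c) The sequence $(x^k)_{k\in\mathbb{N}}$ is weakly convergent to some $\tilde x\in\mathcal{L}_{f+g}(\bar x)$.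
   Context: Setting. $\mathcal{H}$ is a nontrivial real Hilbert space; $f,g:\mathcal{H}\to\mathbb{R}\cup\{+\infty\}$ are proper, lower semicontinuous and convex, with $\operatorname{dom}(g)\subseteq\operatorname{dom}(f)$, where $\operatorname{dom}(h)=\{x: h(x)<+\infty\}$. $\partial$ denotes the convex subdifferential, $\mathbb{N}=\{0,1,2,\dots\}$, and $\mathbb{B}[0;r]$ is the closed ball of radius $r$ centered at $0$. Standing assumptions: A1: $\partial f$ is bounded on bounded sets of $\operatorname{dom}(g)$: for every bounded and closed $V\subseteq\operatorname{dom}(g)$ there is $\zeta>0$ with $\partial f(x)\subseteq\mathbb{B}[0;\zeta]$ for all $x\in V$. A2: there is $\rho\ge 0$ such that $\partial g(x)\cap\mathbb{B}[0;\rho]\ne\emptyset$ for all $x\in\operatorname{dom}(g)$. For $\alpha>0$, $\operatorname{prox}_{\alpha g}(z)$ is the unique minimizer over $y\in\mathcal{H}$ of $\alpha g(y)+\frac12\|y-z\|^2$. PSS Method (Proximal Subgradient Splitting Method): take $x^0\in\operatorname{dom}(g)$ and, for $k\in\mathbb{N}$, set $x^{k+1}=\operatorname{prox}_{\alpha_k g}(x^k-\alpha_k u^k)$, where $u^k\in\partial f(x^k)$ (assumed to exist) and the stepsize $\alpha_k$ is positive. The method stops if $x^{k+1}=x^k$; it is assumed that it never stops, so that $(x^k)_{k\in\mathbb{N}}$ is an infinite sequence. A sequence $(x^k)$ in $\mathcal{H}$ is quasi-Fejér convergent to a nonempty set $S\subseteq\mathcal{H}$ if for every $x\in S$ there is a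 summable sequence $(\epsilon_k)_{k\in\mathbb{N}}$ in $[0,+\infty)$ with $\|x^{k+1}-x\|^2\le\|x^k-x\|^2+\epsilon_k$ for all $k\in\mathbb{N}$. *)

theory Defs
  imports "HOL-Analysis.Analysis"
begin

definition edom :: "('a \<Rightarrow> ereal) \<Rightarrow> 'a set" where
  "edom h = {x. h x < \<infinity>}"

definition proper_fun :: "('a \<Rightarrow> ereal) \<Rightarrow> bool" where
  "proper_fun h \<longleftrightarrow> (\<forall>x. h x \<noteq> -\<infinity>) \<and> edom h \<noteq> {}"

definition lsc_fun :: "('a::topological_space \<Rightarrow> ereal) \<Rightarrow> bool" where
  "lsc_fun h \<longleftrightarrow> (\<forall>x. h x \<le> Liminf (at x) h)"

text \<open>The weights range over the open interval, so that the convention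
  \<open>0 * \<infinity> = 0\<close> of the type ereal never plays a role.\<close>

definition econvex_fun :: "('a::real_vector \<Rightarrow> ereal) \<Rightarrow> bool" where
  "econvex_fun h \<longleftrightarrow>
     (\<forall>x y. \<forall>t\<in>{0<..<1::real}.
        h ((1 - t) *\<^sub>R x + t *\<^sub>R y) \<le> ereal (1 - t) * h x + ereal t * h y)"

text \<open>For proper \<open>h\<close> this set is empty whenever \<open>h x = \<infinity>\<close>.\<close>

definition subdiff :: "('a::real_inner \<Rightarrow> ereal) \<Rightarrow> 'a \<Rightarrow> 'a set" where
  "subdiff h x = {u. \<forall>y. h x + ereal (u \<bullet> (y - x)) \<le> h y}"

definition prox :: "real \<Rightarrow> ('a::real_inner \<Rightarrow> ereal) \<Rightarrow> 'a \<Rightarrow> 'a" where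
  "prox a h z =
     (THE y. is_arg_min (\<lambda>y. ereal a * h y + ereal ((norm (y - z))\<^sup>2 / 2)) (\<lambda>_. True) y)"

text \<open>The last conjunct says that the stopping test \<open>x (Suc k) = x k\<close> is never met.\<close>

definition pss_sequence ::
  "('a::real_inner \<Rightarrow> ereal) \<Rightarrow> ('a \<Rightarrow> ereal) \<Rightarrow> (nat \<Rightarrow> real) \<Rightarrow> (nat \<Rightarrow> 'a) \<Rightarrow> (nat \<Rightarrow> 'a) \<Rightarrow> bool"
where
  "pss_sequence f g \<alpha> u x \<longleftrightarrow>
     x 0 \<in> edom g \<and>
     (\<forall>k. \<alpha> k > 0 \<and> u k \<in> subdiff f (x k) \<and>
          x (Suc k) = prox (\<alpha> k) g (x k - \<alpha> k *\<^sub>R u k) \<and>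
          x (Suc k) \<noteq> x k)"

definition quasi_fejer :: "(nat \<Rightarrow> 'a::real_normed_vector) \<Rightarrow> 'a set \<Rightarrow> bool" where
  "quasi_fejer x S \<longleftrightarrow>
     S \<noteq> {} \<and>
     (\<forall>s\<in>S. \<exists>\<epsilon>::nat \<Rightarrow> real. (\<forall>k. 0 \<le> \<epsilon> k) \<and> summable \<epsilon> \<and>
        (\<forall>k. (norm (x (Suc k) - s))\<^sup>2 \<le> (norm (x k - s))\<^sup>2 + \<epsilon> k))"

definition sublevel :: "('a \<Rightarrow> ereal) \<Rightarrow> ('a \<Rightarrow> ereal) \<Rightarrow> 'a \<Rightarrow> 'a set" where
  "sublevel f g p = {x \<in> edom g. f x + g x \<le> f p + g p}"

definition weakly_converges :: "(nat \<Rightarrow> 'a::real_inner) \<Rightarrow> 'a \<Rightarrow> bool" where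
  "weakly_converges x l \<longleftrightarrow> (\<forall>y. (\<lambda>k. x k \<bullet> y) \<longlonglongrightarrow> l \<bullet> y)"

end

theory Submission
  imports Defs
begin

text \<open>Assumption A2 makes \<open>g\<close> Lipschitz with constant \<open>\<rho>\<close> on its domain, which is therefore
  closed. With \<open>F = f + g\<close>, the variational characterisation of the proximal point gives, for every
  \<open>y\<close> in the domain of \<open>g\<close>,
  \<open>\<parallel>x\<^sub>k\<^sub>+\<^sub>1 - y\<parallel>\<^sup>2 \<le> \<parallel>x\<^sub>k - y\<parallel>\<^sup>2 + 2 \<alpha>\<^sub>k (F y - F x\<^sub>k) + (1 + \<rho>)\<^sup>2 \<beta>\<^sub>k\<^sup>2\<close>.
  Points \<open>y\<close> of the sublevel set yield quasi-Fejer convergence. Taking \<open>y = xbar\<close> shows that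
  \<open>\<alpha>\<^sub>k (F x\<^sub>k - F xbar)\<close> is summable, and taking \<open>y = x\<^sub>k\<close> that the increments of
  \<open>F x\<^sub>k\<close> are at most of order \<open>\<alpha>\<^sub>k\<close>; since the stepsizes are not summable, the values converge to
  \<open>F xbar\<close>. Weak convergence follows by Opial's argument.\<close>

section \<open>Nested closed convex sets in a Hilbert space\<close>

text \<open>Points of nearly minimal norm, one in each set, form a Cauchy sequence by the
  parallelogram law, and their limit lies in every set. This stands in for weak compactness, both
  for the existence of proximal points and for weak cluster points.\<close>

lemma decseq_closed_convex_Inter:
  fixes K :: "nat \<Rightarrow> 'a::{real_inner, complete_space} set"
  assumes cl: "\<And>n. closed (K n)" and cv: "\<And>n. convex (K n)" and ne: "\<And>n. K n \<noteq> {}"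
    and dec: "decseq K" and bd: "bounded (K 0)"
  shows "\<exists>p. \<forall>n. p \<in> K n"
proof -
  define i where "i n = inverse (real (Suc n))" for n
  have i0: "0 < i n" for n by (simp add: i_def)
  define d where "d n = Inf ((\<lambda>y. (norm y)\<^sup>2) ` K n)" for n
  have sub: "K m \<subseteq> K n" if "n \<le> m" for m n
    using dec that by (simp add: decseq_def)
  have bb: "bdd_below ((\<lambda>y. (norm y)\<^sup>2) ` K n)" for n
    by (rule bdd_belowI[of _ 0]) auto
  have d_le: "d n \<le> (norm y)\<^sup>2" if "y \<in> K n" for n y
    unfolding d_def using that bb by (intro cInf_lower) auto
  have "\<exists>y\<in>K n. (norm y)\<^sup>2 < d n + i n" for n
    using cInf_lessD[of "(\<lambda>y. (norm y)\<^sup>2) ` K n" "d n + i n"] ne i0[of n]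
    unfolding d_def by auto
  then obtain p where pK: "\<And>n. p n \<in> K n"
    and pd: "\<And>n. (norm (p n))\<^sup>2 < d n + i n"
    by metis
  have "incseq d"
    unfolding incseq_def d_def using sub ne bb by (auto intro!: cInf_superset_mono image_mono)
  obtain B where B: "\<And>y. y \<in> K 0 \<Longrightarrow> norm y \<le> B"
    using bd by (auto simp: bounded_iff)
  have "d n \<le> B\<^sup>2" for n
    using d_le[OF pK, of n] B[of "p n"] pK[of n] sub[of 0 n]
    by (smt (verit) le0 norm_ge_zero power_mono subsetD)
  then obtain L where L: "d \<longlonglongrightarrow> L" and dL: "\<And>n. d n \<le> L"
    using incseq_convergent[OF \<open>incseq d\<close>, of "B\<^sup>2"] by auto
  \<comment> \<open>The midpoint of \<open>p n\<close> and \<open>p m\<close> lies in the larger set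
    \<open>K n\<close>, so its squared norm is at least \<open>d n\<close>. The parallelogram law
    turns this into a bound on the distance, where \<open>d m \<le> L\<close> accounts for the norm
    of \<open>p m\<close>.\<close>
  have est: "(norm (p n - p m))\<^sup>2 \<le> 2 * (L - d n) + 4 * i n" if "n \<le> m" for m n
  proof -
    have pm: "p m \<in> K n" using pK sub that by blast
    have "(1/2) *\<^sub>R p n + (1/2) *\<^sub>R p m \<in> K n"
      using cv pK pm by (intro convexD) auto
    then have "d n \<le> (norm ((1/2) *\<^sub>R p n + (1/2) *\<^sub>R p m))\<^sup>2" by (rule d_le)
    also have "\<dots> = (norm (p n))\<^sup>2 / 2 + (norm (p m))\<^sup>2 / 2 - (norm (p n - p m))\<^sup>2 / 4"
      unfolding power2_norm_eq_inner
      by (simp add: inner_commute inner_add_left inner_add_right inner_diff_left inner_diff_right field_simps)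
    finally have "(norm (p n - p m))\<^sup>2 \<le> 2 * (norm (p n))\<^sup>2 + 2 * (norm (p m))\<^sup>2 - 4 * d n"
      by simp
    moreover have "i m \<le> i n"
      using that by (simp add: i_def le_imp_inverse_le)
    ultimately show ?thesis using pd[of n] pd[of m] dL[of m] by (smt (verit))
  qed
  have lim0: "(\<lambda>n. 2 * (L - d n) + 4 * i n) \<longlonglongrightarrow> 2 * (L - L) + 4 * 0"
    unfolding i_def by (intro tendsto_intros L LIMSEQ_inverse_real_of_nat)
  have "Cauchy p"
  proof (rule metric_CauchyI)
    fix e :: real assume "e > 0"
    then have "\<forall>\<^sub>F n in sequentially. 2 * (L - d n) + 4 * i n < (e/2)\<^sup>2"
      using lim0 by (intro order_tendstoD(2)[OF lim0]) auto
    then obtain N where N: "2 * (L - d N) + 4 * i N < (e/2)\<^sup>2"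
      by (auto simp: eventually_sequentially)
    have *: "dist (p N) (p m) < e/2" if "m \<ge> N" for m
      using est[OF that] N \<open>e > 0\<close> unfolding dist_norm
      by (intro power2_less_imp_less[of _ "e/2"]) auto
    show "\<exists>M. \<forall>m\<ge>M. \<forall>n\<ge>M. dist (p m) (p n) < e"
      using * by (metis dist_commute dist_triangle_half_l)
  qed
  then obtain q where q: "p \<longlonglongrightarrow> q"
    by (auto simp: Cauchy_convergent_iff convergent_def)
  have "q \<in> K n" for n
  proof (rule Lim_in_closed_set[OF cl _ _ q])
    show "\<forall>\<^sub>F m in sequentially. p m \<in> K n"
      using eventually_ge_at_top[of n] by eventually_elim (use pK sub in blast)
  qed auto
  then show ?thesis by blast
qed

section \<open>Existence and characterisation of proximal points for real-valued functions\<close>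

lemma square_le_affine_imp_le:
  fixes t A B :: real
  assumes "t\<^sup>2 \<le> A + B * t" "0 \<le> B" "0 \<le> t"
  shows "t \<le> 1 + \<bar>A\<bar> + B"
proof (rule ccontr)
  assume "\<not> ?thesis"
  then have "t > 1 + \<bar>A\<bar> + B" by simp
  then have "t * t > t * (1 + \<bar>A\<bar> + B)" using assms by (intro mult_strict_left_mono) auto
  moreover have "t * \<bar>A\<bar> \<ge> 1 * \<bar>A\<bar>"
    using \<open>t > 1 + \<bar>A\<bar> + B\<close> assms by (intro mult_right_mono) auto
  ultimately show False using assms by (simp add: power2_eq_square algebra_simps)
qed

lemma convex_on_norm_diff_sq:
  fixes z :: "'a::real_inner"
  assumes "convex C"
  shows "convex_on C (\<lambda>y. (norm (y - z))\<^sup>2 / 2)"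
proof (rule convex_onI)
  fix t :: real and x y :: 'a assume "0 < t" "t < 1"
  have "(1 - t) * ((norm (x - z))\<^sup>2 / 2) + t * ((norm (y - z))\<^sup>2 / 2)
      - (norm ((1 - t) *\<^sub>R x + t *\<^sub>R y - z))\<^sup>2 / 2 = t * (1 - t) * (norm (x - y))\<^sup>2 / 2"
    unfolding power2_norm_eq_inner by (simp add: inner_commute inner_diff_left inner_diff_right inner_add_left
        inner_add_right field_simps)
  moreover have "t * (1 - t) * (norm (x - y))\<^sup>2 / 2 \<ge> 0"
    using \<open>0 < t\<close> \<open>t < 1\<close> by simp
  ultimately show "(norm ((1 - t) *\<^sub>R x + t *\<^sub>R y - z))\<^sup>2 / 2
     \<le> (1 - t) * ((norm (x - z))\<^sup>2 / 2) + t * ((norm (y - z))\<^sup>2 / 2)" by linarith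
qed fact

lemma convex_on_imp_convex_sublevel:
  assumes "convex_on C h"
  shows "convex {y \<in> C. h y \<le> c}"
  unfolding convex_alt
proof (intro ballI allI impI)
  fix y z and t :: real
  assume *: "y \<in> {y \<in> C. h y \<le> c}" "z \<in> {y \<in> C. h y \<le> c}" "0 \<le> t \<and> t \<le> 1"
  then have "h ((1 - t) *\<^sub>R y + t *\<^sub>R z) \<le> (1 - t) * h y + t * h z"
    using convex_onD[OF assms, of t y z] by auto
  also have "\<dots> \<le> c"
    using * by (intro convex_bound_le) auto
  finally show "(1 - t) *\<^sub>R y + t *\<^sub>R z \<in> {y \<in> C. h y \<le> c}"
    using * convexD_alt[OF convex_on_imp_convex[OF assms]] by auto
qed

text \<open>The Lipschitz bound lets \<open>g\<close> decrease at most linearly, so the quadratic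
  term makes the objective bounded below with bounded sublevel sets. Those at height
  \<open>m + inverse (real (Suc n))\<close> are nested, closed and convex, and a common point
  attains the infimum \<open>m\<close>.\<close>

lemma prox_minimizer_exists:
  fixes g :: "'a::{real_inner, complete_space} \<Rightarrow> real"
  assumes C: "closed C" "convex C" "C \<noteq> {}" and cg: "convex_on C g"
    and lip: "\<rho>-lipschitz_on C g" and a: "a > 0"
  shows "\<exists>p\<in>C. \<forall>y\<in>C. a * g p + (norm (p - z))\<^sup>2 / 2 \<le> a * g y + (norm (y - z))\<^sup>2 / 2"
proof -
  define \<phi> where "\<phi> y = a * g y + (norm (y - z))\<^sup>2 / 2" for y
  obtain w where w: "w \<in> C" using C by auto
  have rho: "\<rho> \<ge> 0" using lip by (rule lipschitz_on_nonneg)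
  \<comment> \<open>The Lipschitz estimate at the reference point \<open>w\<close> is recentred at
    \<open>z\<close> by the triangle inequality; \<open>A\<close> collects the terms free of
    \<open>y\<close>.\<close>
  define A where "A = a * g w - a * \<rho> * norm (z - w)"
  have low: "\<phi> y \<ge> A - a * \<rho> * norm (y - z) + (norm (y - z))\<^sup>2 / 2" if "y \<in> C" for y
  proof -
    have "g w - g y \<le> \<rho> * norm (y - w)"
      using lipschitz_onD[OF lip \<open>y \<in> C\<close> w] by (simp add: dist_norm)
    also have "\<dots> \<le> \<rho> * (norm (y - z) + norm (z - w))"
      using rho norm_triangle_ineq[of "y - z" "z - w"] by (intro mult_left_mono) auto
    finally have "a * (g w - g y) \<le> a * (\<rho> * (norm (y - z) + norm (z - w)))"
      using a by (intro mult_left_mono) auto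
    then show ?thesis unfolding \<phi>_def A_def by (simp add: algebra_simps)
  qed
  have low': "\<phi> y \<ge> A - (a * \<rho>)\<^sup>2 / 2" if "y \<in> C" for y
  proof -
    have "0 \<le> (norm (y - z) - a * \<rho>)\<^sup>2 / 2" by simp
    then show ?thesis using low[OF that] by (simp add: power2_eq_square algebra_simps)
  qed
  define m where "m = Inf (\<phi> ` C)"
  have bb: "bdd_below (\<phi> ` C)" using low' by (rule bdd_belowI2)
  have m_le: "m \<le> \<phi> y" if "y \<in> C" for y
    unfolding m_def using bb that by (intro cInf_lower) auto
  have cont: "continuous_on C \<phi>"
    unfolding \<phi>_def using lipschitz_on_continuous_on[OF lip] by (intro continuous_intros) auto
  have conv: "convex_on C \<phi>"
    unfolding \<phi>_def using a cg C by (intro convex_on_add convex_on_cmul convex_on_norm_diff_sq) auto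
  define K where "K n = {y \<in> C. \<phi> y \<le> m + inverse (real (Suc n))}" for n
  have "\<exists>p. \<forall>n. p \<in> K n"
  proof (rule decseq_closed_convex_Inter)
    fix n
    have "K n = C \<inter> \<phi> -` {..m + inverse (real (Suc n))}" by (auto simp: K_def)
    then show "closed (K n)" using cont C by (simp add: continuous_on_closed_vimage Int_commute)
    show "convex (K n)"
      unfolding K_def using conv by (rule convex_on_imp_convex_sublevel)
    show "K n \<noteq> {}"
      using cInf_lessD[of "\<phi> ` C" "m + inverse (real (Suc n))"] C
      unfolding K_def m_def by fastforce
  next
    show "decseq K"
    proof (rule decseq_SucI)
      fix n
      have "inverse (real (Suc (Suc n))) \<le> inverse (real (Suc n))"
        by (rule le_imp_inverse_le) auto
      then show "K (Suc n) \<subseteq> K n" unfolding K_def by (auto intro: order_trans add_left_mono simp del: of_nat_Suc)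
    qed
  next
    \<comment> \<open>\<open>K 0\<close> is the sublevel set at height \<open>m + 1\<close>, so
      \<open>low\<close> gives \<open>t\<^sup>2 \<le> M + 2 * (a * \<rho>) * t\<close> for
      \<open>t = norm (y - z)\<close>.\<close>
    define M where "M = 2 * (m + 1 - A)"
    have "norm (y - z) \<le> 1 + \<bar>M\<bar> + 2 * (a * \<rho>)" if "y \<in> K 0" for y
      using that low[of y] a rho
      by (intro square_le_affine_imp_le) (auto simp: K_def M_def algebra_simps)
    then show "bounded (K 0)"
      by (intro boundedI[of _ "norm z + (1 + \<bar>M\<bar> + 2 * (a * \<rho>))"])
         (smt (verit) norm_triangle_sub)
  qed
  then obtain p where p: "\<And>n. p \<in> K n" by blast
  have "(\<lambda>n. m + inverse (real (Suc n))) \<longlonglongrightarrow> m + 0"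
    by (intro tendsto_intros LIMSEQ_inverse_real_of_nat)
  then have "\<phi> p \<le> m"
    using p by (intro LIMSEQ_le_const[of _ m]) (auto simp: K_def)
  then show ?thesis
    unfolding \<phi>_def[symmetric] using p[of 0] m_le
    by (intro bexI[of _ p]) (auto simp: K_def intro: order_trans)
qed

text \<open>Minimality of \<open>p\<close> is tested against points of the segment from
  \<open>p\<close> to \<open>y\<close>; after division by \<open>t\<close> the quadratic remainder
  vanishes as \<open>t\<close> tends to 0 from the right.\<close>

lemma prox_minimizer_variational:
  fixes g :: "'a::real_inner \<Rightarrow> real"
  assumes "convex C" "convex_on C g" "a > 0" "p \<in> C" "y \<in> C"
    and min: "\<And>y. y \<in> C \<Longrightarrow> a * g p + (norm (p - z))\<^sup>2 / 2 \<le> a * g y + (norm (y - z))\<^sup>2 / 2"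
  shows "(z - p) \<bullet> (y - p) \<le> a * (g y - g p)"
proof -
  have "(z - p) \<bullet> (y - p) \<le> a * (g y - g p) + t * ((norm (y - p))\<^sup>2 / 2)" if t: "0 < t" "t < 1" for t :: real
  proof -
    let ?q = "(1 - t) *\<^sub>R p + t *\<^sub>R y"
    have "?q \<in> C" using assms t by (intro convexD_alt) auto
    from min[OF this] have "a * g p + (norm (p - z))\<^sup>2 / 2 \<le> a * g ?q + (norm (?q - z))\<^sup>2 / 2" .
    moreover have "a * g ?q \<le> a * ((1 - t) * g p + t * g y)"
      using assms t by (intro mult_left_mono convex_onD) auto
    moreover have "(norm (?q - z))\<^sup>2 = (norm (p - z))\<^sup>2 - 2 * t * ((z - p) \<bullet> (y - p)) + t\<^sup>2 * (norm (y - p))\<^sup>2"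
      unfolding power2_norm_eq_inner by (simp add: inner_commute inner_diff_left inner_diff_right inner_add_left
        inner_add_right algebra_simps power2_eq_square)
    ultimately have "t * ((z - p) \<bullet> (y - p)) \<le> t * (a * (g y - g p) + t * ((norm (y - p))\<^sup>2 / 2))"
      by (simp add: algebra_simps power2_eq_square)
    then show ?thesis using t by simp
  qed
  then have "\<forall>\<^sub>F t in at_right 0. (z - p) \<bullet> (y - p) \<le> a * (g y - g p) + t * ((norm (y - p))\<^sup>2 / 2)"
    using eventually_at_right_real[of 0 "1::real"] by (auto elim: eventually_mono)
  moreover have "((\<lambda>t. a * (g y - g p) + t * ((norm (y - p))\<^sup>2 / 2)) \<longlongrightarrow> a * (g y - g p) + 0 * ((norm (y - p))\<^sup>2 / 2)) (at_right 0)"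
    by (intro tendsto_intros)
  ultimately show ?thesis
    using tendsto_lowerbound by fastforce
qed

section \<open>From extended-real functions to real functions on their domains\<close>

lemma proper_fun_real:
  assumes "proper_fun h" "y \<in> edom h"
  shows "h y = ereal (real_of_ereal (h y))"
  using assms by (cases "h y") (auto simp: proper_fun_def edom_def)

lemma subdiff_real_le:
  assumes "proper_fun h" "y \<in> edom h" "z \<in> edom h" "v \<in> subdiff h y"
  shows "real_of_ereal (h y) + v \<bullet> (z - y) \<le> real_of_ereal (h z)"
proof -
  have "h y + ereal (v \<bullet> (z - y)) \<le> h z" using assms by (simp add: subdiff_def)
  then show ?thesis
    by (subst (asm) proper_fun_real[OF assms(1,2)], subst (asm) proper_fun_real[OF assms(1,3)]) simp
qed

text \<open>A subgradient at \<open>y\<close> bounds \<open>g y - g z\<close> from above, and one at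
  \<open>z\<close> gives the reverse bound; both exist with norm at most \<rho>.\<close>

lemma lipschitz_on_edom:
  fixes g :: "'a::real_inner \<Rightarrow> ereal"
  assumes g: "proper_fun g" and rho: "\<rho> \<ge> 0"
    and sub: "\<And>y. y \<in> edom g \<Longrightarrow> subdiff g y \<inter> cball 0 \<rho> \<noteq> {}"
  shows "\<rho>-lipschitz_on (edom g) (\<lambda>y. real_of_ereal (g y))"
proof -
  have *: "real_of_ereal (g y) - real_of_ereal (g z) \<le> \<rho> * dist y z"
    if yz: "y \<in> edom g" "z \<in> edom g" for y z
  proof -
    obtain v where v: "v \<in> subdiff g y" "norm v \<le> \<rho>"
      using sub[OF yz(1)] by auto
    have "real_of_ereal (g y) - real_of_ereal (g z) \<le> v \<bullet> (y - z)"
      using subdiff_real_le[OF g yz v(1)] by (simp add: inner_diff_right)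
    also have "\<dots> \<le> norm v * norm (y - z)" by (rule norm_cauchy_schwarz)
    also have "\<dots> \<le> \<rho> * dist y z" using v by (auto simp: dist_norm intro: mult_right_mono)
    finally show ?thesis .
  qed
  show ?thesis
  proof (rule lipschitz_onI[OF _ rho])
    fix y z assume "y \<in> edom g" "z \<in> edom g"
    then show "dist (real_of_ereal (g y)) (real_of_ereal (g z)) \<le> \<rho> * dist y z"
      using *[of y z] *[of z y] by (simp add: dist_commute dist_real_def)
  qed
qed

text \<open>The bounds \<open>c n\<close> vary because the applications put Lipschitz or continuous
  terms along the sequence into them.\<close>

lemma lsc_fun_le_limit:
  assumes "lsc_fun h" "X \<longlonglongrightarrow> y" "\<And>n. h (X n) \<le> ereal (c n)" "c \<longlonglongrightarrow> d"
  shows "h y \<le> ereal d"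
proof (rule ccontr)
  assume "\<not> ?thesis"
  then obtain e where e: "ereal d < ereal e" "ereal e < h y"
    using ereal_dense2 by (metis not_le)
  have "ereal e < Liminf (at y) h"
    using e assms(1) by (auto simp: lsc_fun_def intro: less_le_trans)
  then have "\<forall>\<^sub>F z in at y. ereal e < h z" by (rule less_LiminfD)
  \<comment> \<open>The lower limit in \<open>lsc_fun\<close> ignores the point \<open>y\<close>
    itself; \<open>ereal e < h y\<close> restores it, so that \<open>X\<close> may take the value
    \<open>y\<close>.\<close>
  then have "\<forall>\<^sub>F z in nhds y. ereal e < h z"
    using e by (auto simp: eventually_at_filter elim!: eventually_mono)
  then have "\<forall>\<^sub>F n in sequentially. ereal e < h (X n)"
    using assms(2) unfolding filterlim_iff by blast
  moreover have "\<forall>\<^sub>F n in sequentially. c n < e"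
    using assms(4) e by (intro order_tendstoD) auto
  ultimately have "\<forall>\<^sub>F n in sequentially. False"
  proof eventually_elim
    case (elim n)
    have "ereal e < ereal (c n)" using elim(1) assms(3)[of n] by (rule less_le_trans)
    then show ?case using elim(2) by simp
  qed
  then show False by simp
qed

text \<open>Along a convergent sequence in the domain the Lipschitz bound keeps \<open>g\<close>
  bounded above, and lower semicontinuity carries a finite bound to the limit.\<close>

lemma closed_edom:
  fixes g :: "'a::real_inner \<Rightarrow> ereal"
  assumes g: "proper_fun g" "lsc_fun g"
    and lip: "\<rho>-lipschitz_on (edom g) (\<lambda>y. real_of_ereal (g y))"
  shows "closed (edom g)"
  unfolding closed_sequential_limits
proof (intro allI impI, elim conjE)
  fix X l assume X: "\<forall>n. X n \<in> edom g" and l: "X \<longlonglongrightarrow> l"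
  have "g (X n) \<le> ereal (real_of_ereal (g (X 0)) + \<rho> * dist (X n) (X 0))" for n
  proof -
    have "real_of_ereal (g (X n)) \<le> real_of_ereal (g (X 0)) + \<rho> * dist (X n) (X 0)"
      using lipschitz_onD[OF lip, of "X n" "X 0"] X by (auto simp: dist_real_def)
    then show ?thesis using proper_fun_real[OF g(1), of "X n"] X by (metis ereal_less_eq(3))
  qed
  moreover have "(\<lambda>n. real_of_ereal (g (X 0)) + \<rho> * dist (X n) (X 0))
      \<longlonglongrightarrow> real_of_ereal (g (X 0)) + \<rho> * dist l (X 0)"
    by (intro tendsto_intros l)
  ultimately have "g l \<le> ereal (real_of_ereal (g (X 0)) + \<rho> * dist l (X 0))"
    by (rule lsc_fun_le_limit[OF g(2) l])
  then show "l \<in> edom g" by (auto simp: edom_def)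
qed

lemma econvex_fun_real_le:
  assumes h: "proper_fun h" "econvex_fun h" and yz: "y \<in> edom h" "z \<in> edom h"
    and t: "0 < t" "t < 1"
  shows "(1 - t) *\<^sub>R y + t *\<^sub>R z \<in> edom h"
    and "real_of_ereal (h ((1 - t) *\<^sub>R y + t *\<^sub>R z)) \<le> (1 - t) * real_of_ereal (h y) + t * real_of_ereal (h z)"
proof -
  have "h ((1 - t) *\<^sub>R y + t *\<^sub>R z) \<le> ereal (1 - t) * h y + ereal t * h z"
    using h t by (auto simp: econvex_fun_def)
  then have *: "h ((1 - t) *\<^sub>R y + t *\<^sub>R z) \<le> ereal ((1 - t) * real_of_ereal (h y) + t * real_of_ereal (h z))"
    using proper_fun_real[OF h(1) yz(1)] proper_fun_real[OF h(1) yz(2)]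
    by (metis plus_ereal.simps(1) times_ereal.simps(1))
  then show **: "(1 - t) *\<^sub>R y + t *\<^sub>R z \<in> edom h" by (auto simp: edom_def)
  show "real_of_ereal (h ((1 - t) *\<^sub>R y + t *\<^sub>R z)) \<le> (1 - t) * real_of_ereal (h y) + t * real_of_ereal (h z)"
    using * proper_fun_real[OF h(1) **] by (metis ereal_less_eq(3))
qed

lemma convex_edom:
  assumes "proper_fun h" "econvex_fun h"
  shows "convex (edom h)"
  unfolding convex_alt
proof (intro ballI allI impI)
  fix y z and t :: real assume *: "y \<in> edom h" "z \<in> edom h" "0 \<le> t \<and> t \<le> 1"
  show "(1 - t) *\<^sub>R y + t *\<^sub>R z \<in> edom h"
    using * econvex_fun_real_le(1)[OF assms, of y z t]
    by (cases "t = 0"; cases "t = 1") auto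
qed

lemma convex_on_edom:
  assumes "proper_fun h" "econvex_fun h" "convex C" "C \<subseteq> edom h"
  shows "convex_on C (\<lambda>y. real_of_ereal (h y))"
  using assms by (intro convex_onI econvex_fun_real_le(2)) auto

section \<open>The proximal map of an extended-real function\<close>

text \<open>As \<open>prox\<close> is a definite description, nothing is known of it before the
  minimiser is shown to exist uniquely. The objective is infinite off \<open>edom g\<close>, so the
  question reduces to a real function on that closed convex set.\<close>

lemma prox_variational:
  fixes g :: "'a::{real_inner, complete_space} \<Rightarrow> ereal"
  assumes g: "proper_fun g" "lsc_fun g" "econvex_fun g"
    and lip: "\<rho>-lipschitz_on (edom g) (\<lambda>y. real_of_ereal (g y))" and a: "a > 0"
  shows "prox a g z \<in> edom g"
    and "y \<in> edom g \<Longrightarrow> (z - prox a g z) \<bullet> (y - prox a g z)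
      \<le> a * (real_of_ereal (g y) - real_of_ereal (g (prox a g z)))"
proof -
  define G where "G y = real_of_ereal (g y)" for y
  define \<phi> where "\<phi> y = ereal a * g y + ereal ((norm (y - z))\<^sup>2 / 2)" for y
  have C: "closed (edom g)" "convex (edom g)" "edom g \<noteq> {}"
    using closed_edom[OF g(1,2) lip] convex_edom[OF g(1,3)] g(1) by (auto simp: proper_fun_def)
  have cG: "convex_on (edom g) G" unfolding G_def using g C by (intro convex_on_edom) auto
  have in_dom: "\<phi> y = ereal (a * G y + (norm (y - z))\<^sup>2 / 2)" if "y \<in> edom g" for y
    using proper_fun_real[OF g(1) that] unfolding \<phi>_def G_def
    by (metis plus_ereal.simps(1) times_ereal.simps(1))
  have out_dom: "\<phi> y = \<infinity>" if "y \<notin> edom g" for y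
    using that a by (auto simp: \<phi>_def edom_def)
  have iff: "is_arg_min \<phi> (\<lambda>_. True) p \<longleftrightarrow> p \<in> edom g \<and>
      (\<forall>y\<in>edom g. a * G p + (norm (p - z))\<^sup>2 / 2 \<le> a * G y + (norm (y - z))\<^sup>2 / 2)" for p
  proof
    assume p: "is_arg_min \<phi> (\<lambda>_. True) p"
    then have le: "\<phi> p \<le> \<phi> y" for y by (auto simp: is_arg_min_def not_less)
    obtain w where "w \<in> edom g" using C by auto
    then have "p \<in> edom g" using le[of w] in_dom out_dom by force
    then show "p \<in> edom g \<and>
      (\<forall>y\<in>edom g. a * G p + (norm (p - z))\<^sup>2 / 2 \<le> a * G y + (norm (y - z))\<^sup>2 / 2)"
      using le in_dom by (metis ereal_less_eq(3))
  next
    assume p: "p \<in> edom g \<and>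
      (\<forall>y\<in>edom g. a * G p + (norm (p - z))\<^sup>2 / 2 \<le> a * G y + (norm (y - z))\<^sup>2 / 2)"
    have "\<phi> p \<le> \<phi> y" for y
      using p by (cases "y \<in> edom g") (auto simp: in_dom out_dom)
    then show "is_arg_min \<phi> (\<lambda>_. True) p" by (auto simp: is_arg_min_def not_less)
  qed
  have var: "(z - p) \<bullet> (y - p) \<le> a * (G y - G p)"
    if "is_arg_min \<phi> (\<lambda>_. True) p" "y \<in> edom g" for p y
    using that unfolding iff
    by (intro prox_minimizer_variational[OF C(2) cG a]) auto
  obtain p where p: "is_arg_min \<phi> (\<lambda>_. True) p"
    using prox_minimizer_exists[OF C cG lip[folded G_def] a, of z] iff by blast
  \<comment> \<open>Adding the two variational inequalities cancels the values of \<open>G\<close>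
    and leaves the squared distance of the two minimisers.\<close>
  have uniq: "q = p" if q: "is_arg_min \<phi> (\<lambda>_. True) q" for q
  proof -
    have "(z - p) \<bullet> (q - p) \<le> a * (G q - G p)" "(z - q) \<bullet> (p - q) \<le> a * (G p - G q)"
      using var p q iff by blast+
    then have "(z - p) \<bullet> (q - p) + (z - q) \<bullet> (p - q) \<le> 0" by (simp add: algebra_simps)
    moreover have "(z - p) \<bullet> (q - p) + (z - q) \<bullet> (p - q) = (norm (q - p))\<^sup>2"
      unfolding power2_norm_eq_inner by (simp add: inner_diff_left inner_diff_right inner_commute)
    ultimately show ?thesis by simp
  qed
  have "prox a g z = (THE y. is_arg_min \<phi> (\<lambda>_. True) y)"
    unfolding prox_def \<phi>_def ..
  then have eq: "prox a g z = p"
    using the_equality[of "is_arg_min \<phi> (\<lambda>_. True)", OF p uniq] by simp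
  show "prox a g z \<in> edom g" using p iff eq by blast
  show "y \<in> edom g \<Longrightarrow> (z - prox a g z) \<bullet> (y - prox a g z)
      \<le> a * (real_of_ereal (g y) - real_of_ereal (g (prox a g z)))"
    using var[OF p] eq unfolding G_def by blast
qed

section \<open>Convergence of real sequences\<close>

text \<open>Subtracting the partial sums of \<epsilon> leaves a decreasing sequence that is bounded
  below. This serves for the squared distances in the Fejer inequality and for the squared gaps of
  the function values.\<close>

lemma almost_decreasing_convergent:
  fixes a \<epsilon> :: "nat \<Rightarrow> real"
  assumes nn: "\<And>k. 0 \<le> a k" and e: "\<And>k. 0 \<le> \<epsilon> k" "summable \<epsilon>"
    and step: "\<And>k. a (Suc k) \<le> a k + \<epsilon> k"
  shows "convergent a"
proof -
  define s where "s n = (\<Sum>k<n. \<epsilon> k)" for n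
  have s: "s \<longlonglongrightarrow> suminf \<epsilon>" using summable_LIMSEQ[OF e(2)] unfolding s_def .
  have "decseq (\<lambda>n. a n - s n)"
    by (rule decseq_SucI) (use step in \<open>simp add: s_def algebra_simps\<close>)
  moreover have "- suminf \<epsilon> \<le> a n - s n" for n
    using nn[of n] sum_le_suminf[OF e(2), of "{..<n}"] e(1) by (simp add: s_def)
  ultimately obtain L where "(\<lambda>n. a n - s n) \<longlonglongrightarrow> L"
    using decseq_convergent by blast
  from tendsto_add[OF this s] show ?thesis by (auto simp: convergent_def)
qed

text \<open>The squares of \<open>\<theta>\<close> have summable increments, since
  \<open>\<theta> (k+1)\<^sup>2 - \<theta> k\<^sup>2 \<le> 2 C a\<^sub>k \<theta>\<^sub>k + C\<^sup>2 a\<^sub>k\<^sup>2\<close>.\<close>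

lemma weighted_summable_tendsto_0:
  fixes a \<theta> :: "nat \<Rightarrow> real"
  assumes a: "\<And>k. 0 \<le> a k" "\<not> summable a" "summable (\<lambda>k. (a k)\<^sup>2)"
    and \<theta>: "\<And>k. 0 \<le> \<theta> k" "summable (\<lambda>k. a k * \<theta> k)"
    and C: "0 \<le> C" and step: "\<And>k. \<theta> (Suc k) \<le> \<theta> k + C * a k"
  shows "\<theta> \<longlonglongrightarrow> 0"
proof -
  have "convergent (\<lambda>k. (\<theta> k)\<^sup>2)"
  proof (rule almost_decreasing_convergent)
    show "summable (\<lambda>k. 2 * C * (a k * \<theta> k) + C\<^sup>2 * (a k)\<^sup>2)"
      using a \<theta> by (intro summable_add summable_mult)
    show "(\<theta> (Suc k))\<^sup>2 \<le> (\<theta> k)\<^sup>2 + (2 * C * (a k * \<theta> k) + C\<^sup>2 * (a k)\<^sup>2)" for k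
    proof -
      have "(\<theta> (Suc k))\<^sup>2 \<le> (\<theta> k + C * a k)\<^sup>2" using \<theta> step by (intro power_mono) auto
      then show ?thesis by (simp add: power2_eq_square algebra_simps)
    qed
  qed (use a \<theta> C in auto)
  then obtain L where L: "(\<lambda>k. (\<theta> k)\<^sup>2) \<longlonglongrightarrow> L" by (auto simp: convergent_def)
  have lim: "\<theta> \<longlonglongrightarrow> sqrt L" using tendsto_real_sqrt[OF L] \<theta>(1) by simp
  \<comment> \<open>A positive limit would keep \<theta> eventually above half of it, so that
    summability of \<open>a k * \<theta> k\<close> would force that of \<open>a\<close>.\<close>
  have "sqrt L = 0"
  proof (rule ccontr)
    assume "sqrt L \<noteq> 0"
    moreover have "0 \<le> sqrt L" using LIMSEQ_le_const[OF lim] \<theta>(1) by blast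
    ultimately have pos: "0 < sqrt L / 2" "sqrt L / 2 < sqrt L" by auto
    have "\<forall>\<^sub>F k in sequentially. sqrt L / 2 < \<theta> k" using order_tendstoD(1)[OF lim pos(2)] .
    then have "\<forall>\<^sub>F k in sequentially. norm (sqrt L / 2 * a k) \<le> a k * \<theta> k"
    proof eventually_elim
      case (elim k)
      have "sqrt L / 2 * a k \<le> \<theta> k * a k" using elim a(1)[of k] by (intro mult_right_mono) auto
      then show ?case using pos a(1)[of k] by (simp add: abs_mult mult.commute)
    qed
    then have "summable (\<lambda>k. sqrt L / 2 * a k)" using \<theta>(2) by (rule summable_comparison_test_ev)
    then show False using a(2) pos by (subst (asm) summable_cmult_iff) auto
  qed
  then show ?thesis using lim by simp
qed

section \<open>Weak convergence\<close>

text \<open>Opial's argument without weak compactness: the closed convex hulls of the tails of a bounded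
  sequence have a common point, and such a point plays the role of a weak cluster point.\<close>

lemma tail_hull_point:
  fixes X :: "nat \<Rightarrow> 'a::{real_inner, complete_space}"
  assumes "bounded (range X)"
  shows "\<exists>c. \<forall>T. closed T \<and> convex T \<and> (\<forall>\<^sub>F k in sequentially. X k \<in> T) \<longrightarrow> c \<in> T"
proof -
  define K where "K n = closure (convex hull (X ` {n..}))" for n
  have "\<exists>c. \<forall>n. c \<in> K n"
  proof (rule decseq_closed_convex_Inter)
    show "decseq K" unfolding decseq_def K_def by (auto intro!: closure_mono hull_mono)
    obtain B where "\<forall>v\<in>range X. norm v \<le> B"
      using assms unfolding bounded_iff by blast
    then have "K 0 \<subseteq> cball 0 B"
      unfolding K_def by (intro closure_minimal hull_minimal) auto
    then show "bounded (K 0)" by (rule bounded_subset[OF bounded_cball])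
  qed (auto simp: K_def intro!: convex_closure)
  then obtain c where c: "\<And>n. c \<in> K n" by blast
  have "c \<in> T" if T: "closed T" "convex T" "\<forall>\<^sub>F k in sequentially. X k \<in> T" for T
  proof -
    obtain n where "X ` {n..} \<subseteq> T" using T(3) by (auto simp: eventually_sequentially)
    then have "K n \<subseteq> T" unfolding K_def using T by (intro closure_minimal hull_minimal) auto
    then show ?thesis using c by blast
  qed
  then show ?thesis by blast
qed

text \<open>Convergence of the inner products puts a tail of the sequence into every slab around the
  level \<open>L\<close>; slabs are closed and convex, so they contain \<open>c\<close>.\<close>

lemma tail_hull_point_inner:
  fixes X :: "nat \<Rightarrow> 'a::real_inner"
  assumes c: "\<And>T. closed T \<Longrightarrow> convex T \<Longrightarrow> (\<forall>\<^sub>F k in sequentially. X k \<in> T) \<Longrightarrow> c \<in> T"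
    and lim: "(\<lambda>k. X k \<bullet> y) \<longlonglongrightarrow> L"
  shows "c \<bullet> y = L"
proof -
  have "\<bar>c \<bullet> y - L\<bar> \<le> e" if "e > 0" for e
  proof -
    have "c \<in> {v. y \<bullet> v \<le> L + e} \<inter> {v. y \<bullet> v \<ge> L - e}"
    proof (rule c)
      have "\<forall>\<^sub>F k in sequentially. X k \<bullet> y < L + e" "\<forall>\<^sub>F k in sequentially. X k \<bullet> y > L - e"
        using that by (auto intro!: order_tendstoD[OF lim])
      then show "\<forall>\<^sub>F k in sequentially. X k \<in> {v. y \<bullet> v \<le> L + e} \<inter> {v. y \<bullet> v \<ge> L - e}"
        by eventually_elim (auto simp: inner_commute)
    qed (auto intro!: closed_Int convex_Int closed_halfspace_le closed_halfspace_ge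
        convex_halfspace_le convex_halfspace_ge)
    then show ?thesis by (auto simp: inner_commute)
  qed
  then have "\<bar>c \<bullet> y - L\<bar> \<le> 0" using field_le_epsilon[of "\<bar>c \<bullet> y - L\<bar>" 0] by simp
  then show ?thesis by simp
qed

text \<open>A family \<open>T\<close> is used because the sequence may enter each set eventually
  without ever meeting the intersection. The core is that a hull point of a subsequence must equal
  the hull point of the whole sequence.\<close>

lemma opial_weak_convergence:
  fixes X :: "nat \<Rightarrow> 'a::{real_inner, complete_space}" and T :: "'i \<Rightarrow> 'a set"
  assumes T: "\<And>i. i \<in> I \<Longrightarrow> closed (T i)" "\<And>i. i \<in> I \<Longrightarrow> convex (T i)"
    and ev: "\<And>i. i \<in> I \<Longrightarrow> \<forall>\<^sub>F k in sequentially. X k \<in> T i"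
    and bd: "bounded (range X)"
    and dist: "\<And>s. s \<in> (\<Inter>i\<in>I. T i) \<Longrightarrow> convergent (\<lambda>k. (norm (X k - s))\<^sup>2)"
  shows "\<exists>l \<in> (\<Inter>i\<in>I. T i). weakly_converges X l"
proof -
  obtain c where c: "\<And>T. closed T \<Longrightarrow> convex T \<Longrightarrow> (\<forall>\<^sub>F k in sequentially. X k \<in> T) \<Longrightarrow> c \<in> T"
    using tail_hull_point[OF bd] by blast
  have cT: "c \<in> (\<Inter>i\<in>I. T i)" using c T ev by auto
  \<comment> \<open>This one-sided bound, applied to \<open>- y\<close>, also yields the lower one.
    If it fails, a subsequence stays in a closed half-space that misses \<open>c\<close>, and the
    hull point \<open>d\<close> of the subsequence lies there.\<close>
  have upper: "\<forall>\<^sub>F k in sequentially. X k \<bullet> y < c \<bullet> y + e" if "e > 0" for y e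
  proof (rule ccontr)
    assume "\<not> ?thesis"
    then have "\<exists>\<^sub>F k in sequentially. X k \<bullet> y \<ge> c \<bullet> y + e"
      by (simp add: frequently_def not_le)
    then have "infinite {k. X k \<bullet> y \<ge> c \<bullet> y + e}"
      by (simp add: cofinite_eq_sequentially[symmetric] frequently_cofinite)
    then obtain r :: "nat \<Rightarrow> nat" where r: "strict_mono r" "\<And>n. X (r n) \<bullet> y \<ge> c \<bullet> y + e"
      using infinite_enumerate by blast
    have "bounded (range (X \<circ> r))" using bd by (rule bounded_subset) auto
    then obtain d where d: "\<And>T. closed T \<Longrightarrow> convex T \<Longrightarrow> (\<forall>\<^sub>F k in sequentially. (X \<circ> r) k \<in> T) \<Longrightarrow> d \<in> T"
      using tail_hull_point by blast
    have "d \<in> {v. y \<bullet> v \<ge> c \<bullet> y + e}"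
      by (rule d[OF closed_halfspace_ge convex_halfspace_ge])
        (use r in \<open>auto simp: inner_commute\<close>)
    then have dy: "d \<bullet> y \<ge> c \<bullet> y + e" by (simp add: inner_commute)
    have dT: "d \<in> (\<Inter>i\<in>I. T i)"
    proof
      fix i assume "i \<in> I"
      then show "d \<in> T i"
        using eventually_subseq[OF r(1) ev] by (intro d T) auto
    qed
    obtain A B where A: "(\<lambda>k. (norm (X k - c))\<^sup>2) \<longlonglongrightarrow> A" and B: "(\<lambda>k. (norm (X k - d))\<^sup>2) \<longlonglongrightarrow> B"
      using dist[OF cT] dist[OF dT] by (auto simp: convergent_def)
    \<comment> \<open>In the difference of the squared distances to \<open>d\<close> and
      \<open>c\<close> the norm of \<open>X k\<close> cancels, so
      \<open>X k \<bullet> (c - d)\<close> converges to \<open>L\<close>. Both hull points then have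
      inner product \<open>L\<close> with \<open>c - d\<close>, which forces
      \<open>c = d\<close>.\<close>
    define L where "L = (B - A + (norm c)\<^sup>2 - (norm d)\<^sup>2) / 2"
    have "(\<lambda>k. ((norm (X k - d))\<^sup>2 - (norm (X k - c))\<^sup>2 + (norm c)\<^sup>2 - (norm d)\<^sup>2) / 2) \<longlonglongrightarrow> L"
      unfolding L_def by (intro tendsto_intros A B) auto
    moreover have "((norm (X k - d))\<^sup>2 - (norm (X k - c))\<^sup>2 + (norm c)\<^sup>2 - (norm d)\<^sup>2) / 2 = X k \<bullet> (c - d)" for k
      unfolding power2_norm_eq_inner by (simp add: inner_diff_left inner_diff_right inner_commute)
    ultimately have lim: "(\<lambda>k. X k \<bullet> (c - d)) \<longlonglongrightarrow> L" by simp
    then have "(\<lambda>k. (X \<circ> r) k \<bullet> (c - d)) \<longlonglongrightarrow> L"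
      using LIMSEQ_subseq_LIMSEQ[OF lim r(1)] by (simp add: o_def)
    then have "d \<bullet> (c - d) = L" using tail_hull_point_inner[OF d] by blast
    moreover have "c \<bullet> (c - d) = L" using tail_hull_point_inner[OF c lim] by blast
    ultimately have "(c - d) \<bullet> (c - d) = 0" by (simp add: inner_diff_left)
    then show False using dy that by simp
  qed
  have "(\<lambda>k. X k \<bullet> y) \<longlonglongrightarrow> c \<bullet> y" for y
  proof (rule order_tendstoI)
    fix b assume "c \<bullet> y < b"
    then show "\<forall>\<^sub>F k in sequentially. X k \<bullet> y < b" using upper[of "b - c \<bullet> y" y] by simp
  next
    fix b assume "b < c \<bullet> y"
    then show "\<forall>\<^sub>F k in sequentially. b < X k \<bullet> y" using upper[of "c \<bullet> y - b" "- y"] by simp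
  qed
  then show ?thesis using cT by (auto simp: weakly_converges_def)
qed

section \<open>The basic inequality of one step, and sublevel sets of the sum\<close>

text \<open>Passing from values at the new point \<open>p\<close> to values at \<open>x\<close>
  costs \<open>a * (\<rho> + norm u)\<close> times the step length \<open>n\<close>: the Lipschitz
  bound pays for \<open>g\<close>, Cauchy-Schwarz for the subgradient of \<open>f\<close>. The term
  \<open>- n\<^sup>2\<close> in the expanded square absorbs this cost.\<close>

lemma prox_subgradient_step:
  fixes f g :: "'a::{real_inner, complete_space} \<Rightarrow> ereal"
  defines "F \<equiv> \<lambda>y. real_of_ereal (f y) + real_of_ereal (g y)"
  assumes f: "proper_fun f" and g: "proper_fun g" "lsc_fun g" "econvex_fun g"
    and dom: "edom g \<subseteq> edom f"
    and lip: "\<rho>-lipschitz_on (edom g) (\<lambda>y. real_of_ereal (g y))"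
    and a: "a > 0" and u: "u \<in> subdiff f x" and x: "x \<in> edom g" and y: "y \<in> edom g"
  shows "(norm (prox a g (x - a *\<^sub>R u) - y))\<^sup>2
    \<le> (norm (x - y))\<^sup>2 + 2 * a * (F y - F x) + (a * (\<rho> + norm u))\<^sup>2"
proof -
  define p where "p = prox a g (x - a *\<^sub>R u)"
  define n where "n = norm (x - p)"
  note prox = prox_variational[OF g lip a, where z = "x - a *\<^sub>R u", folded p_def]
  have "(x - a *\<^sub>R u - p) \<bullet> (y - p) \<le> a * (real_of_ereal (g y) - real_of_ereal (g p))"
    using prox(2)[OF y] .
  moreover have "real_of_ereal (g x) - real_of_ereal (g p) \<le> \<rho> * n"
    using lipschitz_onD[OF lip x prox(1)] by (simp add: dist_norm n_def)
  then have "a * (real_of_ereal (g x) - real_of_ereal (g p)) \<le> a * (\<rho> * n)"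
    using a by (intro mult_left_mono) auto
  moreover have "u \<bullet> (y - p) \<le> real_of_ereal (f y) - real_of_ereal (f x) + norm u * n"
    using subdiff_real_le[OF f subsetD[OF dom x] subsetD[OF dom y] u] norm_cauchy_schwarz[of u "x - p"]
    by (simp add: n_def inner_diff_right)
  then have "a * (u \<bullet> (y - p)) \<le> a * (real_of_ereal (f y) - real_of_ereal (f x) + norm u * n)"
    using a by (intro mult_left_mono) auto
  moreover have "(x - p) \<bullet> (y - p) = (x - a *\<^sub>R u - p) \<bullet> (y - p) + a * (u \<bullet> (y - p))"
    by (simp add: inner_diff_left)
  ultimately have "(x - p) \<bullet> (y - p) \<le> a * (F y - F x) + a * (\<rho> + norm u) * n"
    unfolding F_def by (simp add: algebra_simps)
  moreover have "(norm (p - y))\<^sup>2 = (norm (x - y))\<^sup>2 - n\<^sup>2 + 2 * ((x - p) \<bullet> (y - p))"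
    unfolding n_def power2_norm_eq_inner
    by (simp add: inner_diff_left inner_diff_right inner_commute)
  \<comment> \<open>Young's inequality, weighted so that \<open>n\<^sup>2\<close> cancels
    exactly.\<close>
  moreover have "0 \<le> (n - a * (\<rho> + norm u))\<^sup>2" by simp
  then have "2 * (a * (\<rho> + norm u) * n) \<le> n\<^sup>2 + (a * (\<rho> + norm u))\<^sup>2"
    by (simp add: power2_diff algebra_simps)
  ultimately show ?thesis unfolding p_def[symmetric] by linarith
qed

text \<open>As \<open>g\<close> is continuous on its closed domain, \<open>c - g (X n)\<close> is a
  convergent bound for \<open>f (X n)\<close>, to which lower semicontinuity of \<open>f\<close>
  applies. These sets feed Opial's argument.\<close>

lemma closed_convex_real_sublevel:
  fixes f g :: "'a::real_inner \<Rightarrow> ereal"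
  assumes f: "proper_fun f" "lsc_fun f" "econvex_fun f"
    and g: "proper_fun g" "lsc_fun g" "econvex_fun g" and dom: "edom g \<subseteq> edom f"
    and lip: "\<rho>-lipschitz_on (edom g) (\<lambda>y. real_of_ereal (g y))"
  shows "closed {y \<in> edom g. real_of_ereal (f y) + real_of_ereal (g y) \<le> c}" (is "closed ?T")
    and "convex {y \<in> edom g. real_of_ereal (f y) + real_of_ereal (g y) \<le> c}"
proof -
  show "closed ?T"
    unfolding closed_sequential_limits
  proof (intro allI impI, elim conjE)
    fix X l assume X: "\<forall>n. X n \<in> ?T" and l: "X \<longlonglongrightarrow> l"
    have lC: "l \<in> edom g"
      using closed_edom[OF g(1,2) lip] X l unfolding closed_sequential_limits by blast
    have "f (X n) \<le> ereal (c - real_of_ereal (g (X n)))" for n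
    proof -
      have "X n \<in> edom f" using X dom by blast
      then show ?thesis using X by (subst proper_fun_real[OF f(1)]) (auto simp: algebra_simps)
    qed
    moreover have "(\<lambda>n. real_of_ereal (g (X n))) \<longlonglongrightarrow> real_of_ereal (g l)"
      using X by (intro continuous_on_tendsto_compose[OF lipschitz_on_continuous_on[OF lip] l lC]) auto
    then have "(\<lambda>n. c - real_of_ereal (g (X n))) \<longlonglongrightarrow> c - real_of_ereal (g l)"
      by (rule tendsto_diff[OF tendsto_const])
    ultimately have "f l \<le> ereal (c - real_of_ereal (g l))"
      by (rule lsc_fun_le_limit[OF f(2) l])
    moreover have "l \<in> edom f" using lC dom by blast
    ultimately show "l \<in> ?T"
      using lC by (subst (asm) proper_fun_real[OF f(1)]) auto
  qed
  have C: "convex (edom g)" using convex_edom[OF g(1,3)] .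
  have "convex_on (edom g) (\<lambda>y. real_of_ereal (f y) + real_of_ereal (g y))"
    using f g dom C by (intro convex_on_add convex_on_edom) auto
  then show "convex ?T" by (rule convex_on_imp_convex_sublevel)
qed

section \<open>Convergence of the method with exogenous stepsizes\<close>

theorem theorem2p6:
  fixes f g :: "'a::{real_inner, complete_space} \<Rightarrow> ereal"
    and x u :: "nat \<Rightarrow> 'a"
    and \<alpha> \<beta> :: "nat \<Rightarrow> real"
    and xbar :: 'a
  assumes nontrivial: "\<exists>v::'a. v \<noteq> 0"
    and f: "proper_fun f" "lsc_fun f" "econvex_fun f"
    and g: "proper_fun g" "lsc_fun g" "econvex_fun g"
    and dom: "edom g \<subseteq> edom f"
    and A1: "\<And>V. bounded V \<Longrightarrow> closed V \<Longrightarrow> V \<subseteq> edom g \<Longrightarrow>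
               \<exists>\<zeta>>0. \<forall>y\<in>V. subdiff f y \<subseteq> cball 0 \<zeta>"
    and A2: "\<exists>\<rho>\<ge>0. \<forall>y\<in>edom g. subdiff g y \<inter> cball 0 \<rho> \<noteq> {}"
    and pss: "pss_sequence f g \<alpha> u x"
    and step: "\<And>k. \<alpha> k = \<beta> k / max 1 (norm (u k))"
    and beta_pos: "\<And>k. \<beta> k > 0"
    and beta_sq: "summable (\<lambda>k. (\<beta> k)\<^sup>2)"
    and beta_div: "filterlim (\<lambda>n. \<Sum>k<n. \<beta> k) at_top sequentially"
    and xbar_dom: "xbar \<in> edom g"
    and xbar_le: "\<And>k. f xbar + g xbar \<le> f (x k) + g (x k)"
  shows "quasi_fejer x (sublevel f g xbar) \<and>
         (\<lambda>k. f (x k) + g (x k)) \<longlonglongrightarrow> f xbar + g xbar \<and>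
         (\<exists>xt \<in> sublevel f g xbar. weakly_converges x xt)"
proof -
  obtain \<rho> where rho: "\<rho> \<ge> 0" "\<And>y. y \<in> edom g \<Longrightarrow> subdiff g y \<inter> cball 0 \<rho> \<noteq> {}"
    using A2 by blast
  define C where "C = edom g"
  \<comment> \<open>\<open>real_of_ereal\<close> sends infinity to 0, so \<open>F\<close> represents
    the sum faithfully only on \<open>C\<close>; membership in \<open>C\<close> is therefore carried
    along in \<open>S\<close> and \<open>T\<close>.\<close>
  define F where "F y = real_of_ereal (f y) + real_of_ereal (g y)" for y
  have lip: "\<rho>-lipschitz_on (edom g) (\<lambda>y. real_of_ereal (g y))"
    using lipschitz_on_edom[OF g(1) rho] .
  have F: "f y + g y = ereal (F y)" if "y \<in> C" for y
  proof -
    have "y \<in> edom f" using that dom by (auto simp: C_def)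
    then show ?thesis
      using proper_fun_real[OF f(1), of y] proper_fun_real[OF g(1), of y] that
      unfolding F_def C_def by (metis plus_ereal.simps(1))
  qed
  have \<alpha>: "\<alpha> k > 0" and u: "u k \<in> subdiff f (x k)"
    and xS: "x (Suc k) = prox (\<alpha> k) g (x k - \<alpha> k *\<^sub>R u k)" for k
    using pss by (auto simp: pss_sequence_def)
  have xC: "x k \<in> C" for k
  proof (induction k)
    case 0
    then show ?case using pss by (simp add: pss_sequence_def C_def)
  next
    case (Suc k)
    then show ?case unfolding xS C_def using prox_variational(1)[OF g lip \<alpha>] by simp
  qed
  have \<beta>: "\<beta> k = max 1 (norm (u k)) * \<alpha> k" for k
  proof -
    have "max 1 (norm (u k)) \<noteq> 0" by linarith
    then show ?thesis by (simp add: step)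
  qed
  \<comment> \<open>Normalisation by \<open>max 1 (norm (u k))\<close> lets \<open>\<beta> k\<close>
    control the error terms before the subgradients are known to be bounded.\<close>
  have \<alpha>\<beta>: "\<alpha> k \<le> \<beta> k" "\<alpha> k * norm (u k) \<le> \<beta> k" for k
  proof -
    have "\<alpha> k * 1 \<le> \<alpha> k * max 1 (norm (u k))"
      "\<alpha> k * norm (u k) \<le> \<alpha> k * max 1 (norm (u k))"
      using \<alpha>[of k] by (auto intro!: mult_left_mono)
    then show "\<alpha> k \<le> \<beta> k" "\<alpha> k * norm (u k) \<le> \<beta> k"
      unfolding \<beta>[of k] by (simp_all add: mult.commute)
  qed
  define M where "M = 1 + \<rho>"
  have M: "M > 0" using rho by (simp add: M_def)
  have key: "(norm (x (Suc k) - y))\<^sup>2 \<le> (norm (x k - y))\<^sup>2 + 2 * \<alpha> k * (F y - F (x k)) + (M * \<beta> k)\<^sup>2"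
    if "y \<in> C" for k y
  proof -
    have "\<alpha> k * (\<rho> + norm (u k)) \<le> M * \<beta> k"
      using \<alpha>\<beta>(2)[of k] mult_left_mono[OF \<alpha>\<beta>(1)[of k] rho(1)] by (simp add: M_def algebra_simps)
    then have "(\<alpha> k * (\<rho> + norm (u k)))\<^sup>2 \<le> (M * \<beta> k)\<^sup>2"
      using \<alpha>[of k] rho by (intro power_mono) auto
    moreover have "(norm (x (Suc k) - y))\<^sup>2 \<le> (norm (x k - y))\<^sup>2 + 2 * \<alpha> k * (F y - F (x k))
        + (\<alpha> k * (\<rho> + norm (u k)))\<^sup>2"
      using prox_subgradient_step[OF f(1) g dom lip \<alpha> u, of k y] xC[of k] that
      unfolding xS F_def C_def by simp
    ultimately show ?thesis by linarith
  qed
  have sum_sq: "summable (\<lambda>k. (M * \<beta> k)\<^sup>2)"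
    using beta_sq by (simp add: power_mult_distrib summable_mult)
  define S where "S = sublevel f g xbar"
  have S: "S = {y \<in> C. F y \<le> F xbar}"
    using F xbar_dom by (auto simp: S_def sublevel_def C_def)
  have xbarC: "xbar \<in> C" using xbar_dom by (simp add: C_def)
  have F_ge: "F xbar \<le> F (x k)" for k
    using xbar_le[of k] F[OF xbarC] F[OF xC] by simp
  have fejer: "(norm (x (Suc k) - s))\<^sup>2 \<le> (norm (x k - s))\<^sup>2 + (M * \<beta> k)\<^sup>2" if "s \<in> S" for k s
  proof -
    have "2 * \<alpha> k * (F s - F (x k)) \<le> 0"
      using that F_ge[of k] \<alpha>[of k] by (intro mult_nonneg_nonpos) (auto simp: S)
    then show ?thesis using key[of s k] that by (simp add: S)
  qed
  have qf: "quasi_fejer x S"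
    unfolding quasi_fejer_def
  proof (intro conjI ballI)
    show "S \<noteq> {}" using xbarC by (auto simp: S)
  next
    fix s assume "s \<in> S"
    then show "\<exists>\<epsilon>::nat \<Rightarrow> real. (\<forall>k. 0 \<le> \<epsilon> k) \<and> summable \<epsilon> \<and>
        (\<forall>k. (norm (x (Suc k) - s))\<^sup>2 \<le> (norm (x k - s))\<^sup>2 + \<epsilon> k)"
      using fejer sum_sq by (intro exI[of _ "\<lambda>k. (M * \<beta> k)\<^sup>2"]) auto
  qed
  have dist_conv: "convergent (\<lambda>k. (norm (x k - s))\<^sup>2)" if "s \<in> S" for s
    by (rule almost_decreasing_convergent[OF _ _ sum_sq fejer[OF that]]) auto
  have xbarS: "xbar \<in> S" using xbarC by (simp add: S)
  have bd: "bounded (range x)"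
  proof -
    have "convergent (\<lambda>k. norm (x k - xbar))"
      using dist_conv[OF xbarS] tendsto_real_sqrt by (force simp: convergent_def)
    then have "Bseq (\<lambda>k. norm (x k - xbar))" by (rule convergent_imp_Bseq)
    then obtain B where "\<And>k. norm (x k - xbar) \<le> B" by (auto simp: Bseq_def)
    then have "range x \<subseteq> cball xbar B" by (auto simp: dist_norm norm_minus_commute)
    then show ?thesis by (rule bounded_subset[OF bounded_cball])
  qed
  \<comment> \<open>A1 asks for a closed set, hence the closure of the bounded range, which stays in
    the closed set \<open>C\<close>.\<close>
  have "closure (range x) \<subseteq> C"
    using xC closed_edom[OF g(1,2) lip] by (intro closure_minimal) (auto simp: C_def)
  then obtain \<zeta> where \<zeta>: "\<zeta> > 0" "\<And>y. y \<in> closure (range x) \<Longrightarrow> subdiff f y \<subseteq> cball 0 \<zeta>"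
    using A1[OF bounded_closure[OF bd] closed_closure] unfolding C_def by blast
  have u_le: "norm (u k) \<le> \<zeta>" for k
  proof -
    have "x k \<in> closure (range x)" by (rule subsetD[OF closure_subset]) auto
    from subsetD[OF \<zeta>(2)[OF this] u] show ?thesis by simp
  qed
  \<comment> \<open>Once the subgradients are bounded by \<zeta>, the normalising factor is at most
    \<open>Z\<close>; this transfers the divergence of the sum of \<beta> to that of
    \<alpha>.\<close>
  define Z where "Z = max 1 \<zeta>"
  have \<beta>_le: "\<beta> k \<le> Z * \<alpha> k" for k
  proof -
    have "max 1 (norm (u k)) * \<alpha> k \<le> Z * \<alpha> k"
      using \<alpha>[of k] u_le[of k] by (intro mult_right_mono) (auto simp: Z_def)
    then show ?thesis unfolding \<beta>[of k] .
  qed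
  define \<theta> where "\<theta> k = F (x k) - F xbar" for k
  have \<theta>0: "0 \<le> \<theta> k" for k using F_ge by (simp add: \<theta>_def)
  have "\<theta> \<longlonglongrightarrow> 0"
  proof (rule weighted_summable_tendsto_0)
    show "0 \<le> \<alpha> k" for k using \<alpha>[of k] by simp
    show "\<not> summable \<alpha>"
    proof
      assume "summable \<alpha>"
      then have "summable (\<lambda>k. Z * \<alpha> k)" by (rule summable_mult)
      then have "summable \<beta>"
        by (rule summable_comparison_test'[where N = 0])
          (use \<beta>_le beta_pos in \<open>auto simp: less_imp_le\<close>)
      then have "(\<lambda>n. \<Sum>k<n. \<beta> k) \<longlonglongrightarrow> suminf \<beta>" by (rule summable_LIMSEQ)
      then show False
        using not_tendsto_and_filterlim_at_infinity[OF sequentially_bot]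
          filterlim_at_top_imp_at_infinity[OF beta_div] by blast
    qed
    show "summable (\<lambda>k. (\<alpha> k)\<^sup>2)"
      by (rule summable_comparison_test'[OF beta_sq, of 0])
        (use \<alpha> \<alpha>\<beta> in \<open>auto intro!: power_mono simp: less_imp_le\<close>)
    show "0 \<le> \<theta> k" for k by (rule \<theta>0)
    show "summable (\<lambda>k. \<alpha> k * \<theta> k)"
    proof -
      define b where "b = suminf (\<lambda>k. (M * \<beta> k)\<^sup>2)"
      \<comment> \<open>\<open>key\<close> at \<open>xbar\<close>, telescoped.\<close>
      have part: "(\<Sum>k<n. 2 * (\<alpha> k * \<theta> k)) + (norm (x n - xbar))\<^sup>2
          \<le> (norm (x 0 - xbar))\<^sup>2 + (\<Sum>k<n. (M * \<beta> k)\<^sup>2)" for n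
      proof (induction n)
        case (Suc n)
        then show ?case using key[OF xbarC, of n] by (simp add: \<theta>_def algebra_simps)
      qed simp
      have "(\<Sum>k<n. (M * \<beta> k)\<^sup>2) \<le> b" for n
        unfolding b_def using sum_sq by (intro sum_le_suminf) auto
      then have "(\<Sum>k<n. 2 * (\<alpha> k * \<theta> k)) \<le> (norm (x 0 - xbar))\<^sup>2 + b" for n
        by (smt (verit) part zero_le_power2)
      then have "summable (\<lambda>k. 2 * (\<alpha> k * \<theta> k))"
        using \<alpha> \<theta>0 by (intro summableI_nonneg_bounded) (auto intro!: mult_nonneg_nonneg simp: less_imp_le)
      then show ?thesis by (subst (asm) summable_cmult_iff) auto
    qed
    show "0 \<le> (\<zeta> + \<rho>) * (M * Z)" using \<zeta> rho M by (simp add: Z_def)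
    show "\<theta> (Suc k) \<le> \<theta> k + (\<zeta> + \<rho>) * (M * Z) * \<alpha> k" for k
    proof -
      let ?d = "norm (x (Suc k) - x k)"
      \<comment> \<open>With \<open>y = x k\<close> both the distance and the \<open>F\<close> term
        on the right of \<open>key\<close> vanish, leaving a bound on the step length.\<close>
      have "?d\<^sup>2 \<le> (M * \<beta> k)\<^sup>2" using key[OF xC[of k], of k] by simp
      then have d: "?d \<le> M * \<beta> k"
        by (rule power2_le_imp_le) (use M beta_pos[of k] in simp)
      \<comment> \<open>The subgradient at the new point is the one that bounds the increase of
        \<open>f\<close> from above.\<close>
      have "u (Suc k) \<bullet> (x (Suc k) - x k) \<le> norm (u (Suc k)) * ?d"
        by (rule norm_cauchy_schwarz)
      also have "\<dots> \<le> \<zeta> * ?d" using u_le by (intro mult_right_mono) auto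
      finally have "real_of_ereal (f (x (Suc k))) - real_of_ereal (f (x k)) \<le> \<zeta> * ?d"
        using subdiff_real_le[OF f(1) _ _ u, of "Suc k" "x k"] xC[of k] xC[of "Suc k"] dom
        unfolding C_def by (simp add: inner_diff_right subset_iff)
      moreover have "real_of_ereal (g (x (Suc k))) - real_of_ereal (g (x k)) \<le> \<rho> * ?d"
        using lipschitz_onD[OF lip, of "x (Suc k)" "x k"] xC unfolding C_def
        by (auto simp: dist_norm)
      ultimately have "\<theta> (Suc k) - \<theta> k \<le> (\<zeta> + \<rho>) * ?d"
        by (simp add: \<theta>_def F_def algebra_simps)
      also have "\<dots> \<le> (\<zeta> + \<rho>) * (M * (Z * \<alpha> k))"
        using order_trans[OF d mult_left_mono[OF \<beta>_le]] M \<zeta>(1) rho(1)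
        by (intro mult_left_mono) auto
      finally show ?thesis by (simp add: algebra_simps)
    qed
  qed
  then have "(\<lambda>k. \<theta> k + F xbar) \<longlonglongrightarrow> 0 + F xbar" by (intro tendsto_intros)
  then have Flim: "(\<lambda>k. F (x k)) \<longlonglongrightarrow> F xbar" by (simp add: \<theta>_def)
  then have lim: "(\<lambda>k. f (x k) + g (x k)) \<longlonglongrightarrow> f xbar + g xbar"
    using F xC xbarC by simp
  \<comment> \<open>The iterates need not reach \<open>S\<close>, but they eventually enter every
    \<open>T e\<close> with \<open>e > 0\<close>.\<close>
  define T where "T e = {y \<in> C. F y \<le> F xbar + e}" for e
  have ST: "S = (\<Inter>e\<in>{0<..}. T e)"
  proof
    show "S \<subseteq> (\<Inter>e\<in>{0<..}. T e)" by (auto simp: S T_def)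
    show "(\<Inter>e\<in>{0<..}. T e) \<subseteq> S"
    proof
      fix y assume y: "y \<in> (\<Inter>e\<in>{0<..}. T e)"
      then have "F y \<le> F xbar + e" if "e > 0" for e using that by (auto simp: T_def)
      then have "F y \<le> F xbar" by (rule field_le_epsilon)
      moreover have "y \<in> T 1" using y by auto
      ultimately show "y \<in> S" by (auto simp: S T_def)
    qed
  qed
  have "\<exists>l \<in> (\<Inter>e\<in>{0<..}. T e). weakly_converges x l"
  proof (rule opial_weak_convergence[OF _ _ _ bd])
    fix e :: real assume e: "e \<in> {0<..}"
    show "closed (T e)" "convex (T e)"
      unfolding T_def F_def C_def by (rule closed_convex_real_sublevel[OF f g dom lip])+
    have "\<forall>\<^sub>F k in sequentially. F (x k) < F xbar + e"
      using e by (intro order_tendstoD(2)[OF Flim]) auto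
    then show "\<forall>\<^sub>F k in sequentially. x k \<in> T e"
      by eventually_elim (use xC in \<open>auto simp: T_def\<close>)
  next
    fix s assume "s \<in> (\<Inter>e\<in>{0<..}. T e)"
    then show "convergent (\<lambda>k. (norm (x k - s))\<^sup>2)" using dist_conv ST by simp
  qed
  then show ?thesis using qf lim ST unfolding S_def by simp
qed

end
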